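(* Let $\alpha\in\mathbb{R}$ and, for integers $N\ge2$, let $C_{\alpha,N}:=\min_{p=0,1,\ldots,N-2}\min_{q\in\mathbb{Z}}|(2p+1)\alpha-2q|$. Then the infimum $$C_\alpha:=\inf_{N}C_{\alpha,N}=\inf_{p,q\in\mathbb{Z}}|(2p+1)\alpha-2q|$$ equals $$C_\alpha=\begin{cases}\frac1\nu,&\text{if }\alpha=\frac{\mu}{\nu}\text{ with }\mu\in\mathbb{Z},\ \nu\in\mathbb{N}_+\text{ relatively prime and }\mu\text{ odd},\\0,&\text{otherwise.}\end{cases}$$ Hence $C_\alpha$ is strictly positive whenever $\alpha$ is an odd numerator fraction, but zero otherwise.
   Context: The infimum over $N$ is over all integers $N\ge2$ (those for which $C_{\alpha,N}$ is defined). $\mathbb{N}_+$ denotes the positive integers. *)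

theory Defs imports Complex_Main begin

(* The inner minimum ranges over an infinite set of reals, so it is written with LEAST
   (the smallest element of the set, not its infimum); minimum_attained below shows
   that it exists. *)
definition C_min :: "real \<Rightarrow> nat \<Rightarrow> real" where
  "C_min \<alpha> N =
     Min ((\<lambda>p. LEAST m. m \<in> range (\<lambda>q::int. \<bar>(2 * real p + 1) * \<alpha> - 2 * of_int q\<bar>)) ` {0..N - 2})"

definition C_inf :: "real \<Rightarrow> real" where
  "C_inf \<alpha> = (INF N\<in>{2..}. C_min \<alpha> N)"

definition odd_numerator_rep :: "real \<Rightarrow> int \<Rightarrow> nat \<Rightarrow> bool" where
  "odd_numerator_rep \<alpha> \<mu> \<nu> \<longleftrightarrow>
     \<nu> > 0 \<and> coprime \<mu> (int \<nu>) \<and> odd \<mu> \<and> \<alpha> = of_int \<mu> / of_nat \<nu>"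

definition odd_numerator_fraction :: "real \<Rightarrow> bool" where
  "odd_numerator_fraction \<alpha> \<longleftrightarrow> (\<exists>\<mu> \<nu>. odd_numerator_rep \<alpha> \<mu> \<nu>)"

lemma minimum_attained:
  fixes x :: real
  shows "\<exists>q::int. \<forall>r::int. \<bar>x - 2 * of_int q\<bar> \<le> \<bar>x - 2 * of_int r\<bar>"
proof (intro exI allI)
  fix r :: int
  have "\<bar>x / 2 - of_int (round (x / 2))\<bar> \<le> \<bar>x / 2 - of_int r\<bar>"
    by (rule round_diff_minimal)
  then show "\<bar>x - 2 * of_int (round (x / 2))\<bar> \<le> \<bar>x - 2 * of_int r\<bar>"
    by linarith
qed

end

theory Submission
  imports Defs "HOL-Analysis.Kronecker_Approximation_Theorem"
begin

text \<open>
  Negating an odd multiple of \<open>\<alpha>\<close> permits restricting to nonnegative \<open>p\<close>, which gives the double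
  infimum. If \<open>\<alpha> = \<mu>/\<nu>\<close> in lowest terms with \<open>\<mu>\<close> odd, then \<open>(2p+1)\<mu> - 2q\<nu>\<close> is odd, hence
  at least 1 in absolute value, and Bezout for the coprime pair \<open>\<mu>, 2\<nu>\<close> attains 1. If \<open>\<mu>\<close>
  is even then \<open>\<nu>\<close> is odd and \<open>\<nu>\<alpha>\<close> is an even integer. If \<open>\<alpha>\<close> is irrational, the numbers
  \<open>k\<alpha> - h\<close> come arbitrarily close to \<open>-\<alpha>/2\<close>.
\<close>

text \<open>Letting \<open>p\<close> range over all of \<open>int\<close> covers the double infimum
  directly; the natural indices in \<open>C_min\<close> embed via \<open>int\<close>.\<close>

definition odd_even_gap :: "real \<Rightarrow> int \<Rightarrow> int \<Rightarrow> real" where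
  "odd_even_gap \<alpha> p q = \<bar>(2 * of_int p + 1) * \<alpha> - 2 * of_int q\<bar>"

lemma odd_even_gap_nonneg: "0 \<le> odd_even_gap \<alpha> p q"
  by (simp add: odd_even_gap_def)

text \<open>The map sending \<open>p\<close> to \<open>- p - 1\<close> negates
  \<open>2 * p + 1\<close> and exchanges negative with nonnegative integers, the only ones that
  \<open>C_min\<close> sees.\<close>

lemma odd_even_gap_reflect: "odd_even_gap \<alpha> (- p - 1) (- q) = odd_even_gap \<alpha> p q"
proof -
  have "(2 * of_int (- p - 1) + 1) * \<alpha> - 2 * of_int (- q)
      = - ((2 * of_int p + 1) * \<alpha> - 2 * of_int q)"
    by (simp add: algebra_simps)
  then show ?thesis
    unfolding odd_even_gap_def by (metis abs_minus_cancel)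
qed

lemma bdd_below_odd_even_gap: "bdd_below ((\<lambda>(p, q). odd_even_gap \<alpha> p q) ` A)"
  by (rule bdd_belowI[of _ 0]) (auto simp: odd_even_gap_nonneg)

text \<open>On the reals \<open>LEAST\<close> is informative only when a minimum exists;
  \<open>minimum_attained\<close> provides it, and the two usual properties of a minimum
  follow.\<close>

lemma Least_dist_even_integers:
  fixes x :: real
  defines "L \<equiv> LEAST m. m \<in> range (\<lambda>q::int. \<bar>x - 2 * of_int q\<bar>)"
  shows "\<exists>q::int. L = \<bar>x - 2 * of_int q\<bar>" and "L \<le> \<bar>x - 2 * of_int r\<bar>"
proof -
  obtain q :: int where q: "\<And>r::int. \<bar>x - 2 * of_int q\<bar> \<le> \<bar>x - 2 * of_int r\<bar>"
    using minimum_attained by blast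
  have "L = \<bar>x - 2 * of_int q\<bar>"
    unfolding L_def by (rule Least_equality) (use q in auto)
  then show "\<exists>q::int. L = \<bar>x - 2 * of_int q\<bar>" and "L \<le> \<bar>x - 2 * of_int r\<bar>"
    using q by auto
qed

lemma C_min_attained: "\<exists>p q. C_min \<alpha> N = odd_even_gap \<alpha> p q"
proof -
  let ?L = "\<lambda>p. LEAST m. m \<in> range (\<lambda>q::int. \<bar>(2 * real p + 1) * \<alpha> - 2 * of_int q\<bar>)"
  have "C_min \<alpha> N \<in> ?L ` {0..N - 2}"
    unfolding C_min_def by (rule Min_in) auto
  then obtain p where p: "C_min \<alpha> N = ?L p"
    by blast
  obtain q :: int where "?L p = \<bar>(2 * real p + 1) * \<alpha> - 2 * of_int q\<bar>"
    using Least_dist_even_integers(1) by blast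
  with p have "C_min \<alpha> N = odd_even_gap \<alpha> (int p) q"
    by (simp add: odd_even_gap_def)
  then show ?thesis
    by blast
qed

lemma C_min_le:
  assumes "p \<le> N - 2"
  shows "C_min \<alpha> N \<le> odd_even_gap \<alpha> (int p) q"
proof -
  let ?L = "\<lambda>p. LEAST m. m \<in> range (\<lambda>q::int. \<bar>(2 * real p + 1) * \<alpha> - 2 * of_int q\<bar>)"
  have "C_min \<alpha> N \<le> ?L p"
    unfolding C_min_def by (rule Min_le) (use assms in auto)
  also have "\<dots> \<le> odd_even_gap \<alpha> (int p) q"
    using Least_dist_even_integers(2)[of "(2 * real p + 1) * \<alpha>" q]
    by (simp add: odd_even_gap_def)
  finally show ?thesis .
qed

lemma C_inf_le: "C_inf \<alpha> \<le> odd_even_gap \<alpha> p q"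
proof -
  have nat: "C_inf \<alpha> \<le> odd_even_gap \<alpha> (int k) r" for k r
  proof -
    have "bdd_below (C_min \<alpha> ` {2..})"
      using C_min_attained odd_even_gap_nonneg by (intro bdd_belowI2[of _ 0]) metis
    \<comment> \<open>\<open>k + 2\<close> is the smallest admissible \<open>N\<close> whose index
      range \<open>{0..N - 2}\<close> contains \<open>k\<close>.\<close>
    then have "C_inf \<alpha> \<le> C_min \<alpha> (k + 2)"
      unfolding C_inf_def by (rule cINF_lower) simp
    also have "\<dots> \<le> odd_even_gap \<alpha> (int k) r"
      by (rule C_min_le) simp
    finally show ?thesis .
  qed
  show ?thesis
  proof (cases "0 \<le> p")
    case True
    then show ?thesis
      using nat[of "nat p" q] by simp
  next
    case False
    then show ?thesis
      using nat[of "nat (- p - 1)" "- q"] by (simp add: odd_even_gap_reflect)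
  qed
qed

text \<open>Each \<open>C_min\<close> value is itself a gap, so it inherits any common lower bound.
  With \<open>C_inf_le\<close> this characterizes \<open>C_inf\<close>; all later arguments work
  through these two facts instead of \<open>C_min\<close>.\<close>

lemma C_inf_greatest:
  assumes "\<And>p q. c \<le> odd_even_gap \<alpha> p q"
  shows "c \<le> C_inf \<alpha>"
  unfolding C_inf_def
proof (rule cINF_greatest)
  show "c \<le> C_min \<alpha> N" for N
    using C_min_attained[of \<alpha> N] assms by auto
qed auto

lemma C_inf_eq_INF: "C_inf \<alpha> = (INF (p, q)\<in>UNIV. odd_even_gap \<alpha> p q)"
proof (rule antisym)
  show "C_inf \<alpha> \<le> (INF (p, q)\<in>UNIV. odd_even_gap \<alpha> p q)"
    by (rule cINF_greatest) (auto intro: C_inf_le)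
  show "(INF (p, q)\<in>UNIV. odd_even_gap \<alpha> p q) \<le> C_inf \<alpha>"
  proof (rule C_inf_greatest)
    show "(INF (p, q)\<in>UNIV. odd_even_gap \<alpha> p q) \<le> odd_even_gap \<alpha> p q" for p q
      using cINF_lower[OF bdd_below_odd_even_gap, of "(p, q)" UNIV] by auto
  qed
qed

text \<open>Clearing the denominator leaves an integer numerator, to which parity and Bezout
  apply.\<close>

lemma odd_even_gap_fraction:
  assumes "\<nu> > 0"
  shows "odd_even_gap (of_int \<mu> / of_nat \<nu>) p q
       = of_int \<bar>(2 * p + 1) * \<mu> - 2 * q * int \<nu>\<bar> / of_nat \<nu>"
proof -
  have "(2 * of_int p + 1) * (of_int \<mu> / of_nat \<nu>) - 2 * of_int q
      = of_int ((2 * p + 1) * \<mu> - 2 * q * int \<nu>) / real \<nu>"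
    using assms by (simp add: field_simps)
  then show ?thesis
    by (simp add: odd_even_gap_def)
qed

lemma C_inf_odd_numerator:
  assumes "odd_numerator_rep \<alpha> \<mu> \<nu>"
  shows "C_inf \<alpha> = 1 / of_nat \<nu>"
proof (rule antisym)
  from assms have \<nu>: "\<nu> > 0" and cop: "coprime \<mu> (int \<nu>)" and "odd \<mu>"
    and \<alpha>: "\<alpha> = of_int \<mu> / of_nat \<nu>"
    by (auto simp: odd_numerator_rep_def)
  \<comment> \<open>Bezout is applied with \<open>2 * int \<nu>\<close> because the second summand
    is then even, which forces the coefficient \<open>x\<close> of \<open>\<mu>\<close> to be odd,
    hence of the form \<open>2 * p + 1\<close>.\<close>
  have "coprime \<mu> (2 * int \<nu>)"
    using cop \<open>odd \<mu>\<close> by simp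
  then obtain x y where xy: "x * \<mu> + y * (2 * int \<nu>) = 1"
    using bezout_int[of \<mu> "2 * int \<nu>"] by (auto simp: coprime_iff_gcd_eq_1)
  have "odd (x * \<mu> + y * (2 * int \<nu>))"
    unfolding xy by simp
  then have "odd x"
    by auto
  then obtain p where "x = 2 * p + 1"
    by (auto elim: oddE)
  then have "(2 * p + 1) * \<mu> - 2 * (- y) * int \<nu> = 1"
    using xy by (simp add: algebra_simps)
  then show "C_inf \<alpha> \<le> 1 / of_nat \<nu>"
    using C_inf_le[of \<alpha> p "- y"] odd_even_gap_fraction[OF \<nu>, of \<mu> p "- y"] \<alpha> by simp
  show "1 / of_nat \<nu> \<le> C_inf \<alpha>"
  proof (rule C_inf_greatest)
    fix p q
    have "odd ((2 * p + 1) * \<mu> - 2 * q * int \<nu>)"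
      using \<open>odd \<mu>\<close> by simp
    then have "(2 * p + 1) * \<mu> - 2 * q * int \<nu> \<noteq> 0"
      by (metis even_zero)
    then have "1 \<le> \<bar>(2 * p + 1) * \<mu> - 2 * q * int \<nu>\<bar>"
      by linarith
    then have "1 \<le> real_of_int \<bar>(2 * p + 1) * \<mu> - 2 * q * int \<nu>\<bar>"
      by linarith
    then show "1 / of_nat \<nu> \<le> odd_even_gap \<alpha> p q"
      unfolding \<alpha> odd_even_gap_fraction[OF \<nu>] by (rule divide_right_mono) simp
  qed
qed

lemma C_inf_nonneg: "0 \<le> C_inf \<alpha>"
  by (rule C_inf_greatest) (rule odd_even_gap_nonneg)

lemma C_inf_irrational:
  assumes "\<alpha> \<notin> \<rat>"
  shows "C_inf \<alpha> = 0"
proof (rule antisym)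
  show "C_inf \<alpha> \<le> 0"
  proof (rule field_le_epsilon)
    fix e :: real
    assume "e > 0"
    then have "e / 2 > 0"
      by simp
    \<comment> \<open>Doubling explains both the target and the tolerance:
      \<open>k * \<alpha> - h\<close> within \<open>e / 2\<close> of \<open>- \<alpha> / 2\<close>
      puts \<open>(2 * k + 1) * \<alpha> - 2 * h\<close> within \<open>e\<close> of 0.\<close>
    from sequence_of_fractional_parts_is_dense[OF assms this, of "- \<alpha> / 2"]
    obtain h k where "\<bar>of_int k * \<alpha> - of_int h - (- \<alpha> / 2)\<bar> < e / 2"
      by blast
    then have "odd_even_gap \<alpha> k h < e"
      unfolding odd_even_gap_def by (simp add: algebra_simps abs_if split: if_splits)
    then show "C_inf \<alpha> \<le> 0 + e"
      using C_inf_le[of \<alpha> k h] by simp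
  qed
qed (rule C_inf_nonneg)

lemma C_inf_rational:
  assumes "\<alpha> \<in> \<rat>" and "\<not> odd_numerator_fraction \<alpha>"
  shows "C_inf \<alpha> = 0"
proof (rule antisym)
  obtain \<mu> b where b: "b > 0" and cop: "coprime \<mu> b" and \<alpha>: "\<alpha> = of_int \<mu> / of_int b"
    using assms(1) by (metis Rats_cases')
  \<comment> \<open>Since \<open>b > 0\<close>, \<open>nat b\<close> loses nothing, and an odd
    \<open>\<mu>\<close> would make \<open>\<alpha>\<close> an odd numerator fraction.\<close>
  then have "odd_numerator_rep \<alpha> \<mu> (nat b) \<longleftrightarrow> odd \<mu>"
    by (simp add: odd_numerator_rep_def)
  then have "even \<mu>"
    using assms(2) by (auto simp: odd_numerator_fraction_def)
  then have "odd b"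
    using cop by (meson coprime_common_divisor odd_one)
  from \<open>even \<mu>\<close> \<open>odd b\<close> obtain q p where "\<mu> = 2 * q" "b = 2 * p + 1"
    by (meson evenE oddE)
  \<comment> \<open>The odd denominator serves as the multiplier:
    \<open>(2 * p + 1) * \<alpha> = b * \<alpha> = \<mu> = 2 * q\<close>.\<close>
  then have "odd_even_gap \<alpha> p q = 0"
    using \<alpha> b by (simp add: odd_even_gap_def)
  then show "C_inf \<alpha> \<le> 0"
    using C_inf_le[of \<alpha> p q] by simp
qed (rule C_inf_nonneg)

theorem proposition5:
  fixes \<alpha> :: real
  shows "C_inf \<alpha> = (INF (p, q)\<in>(UNIV :: (int \<times> int) set). \<bar>(2 * of_int p + 1) * \<alpha> - 2 * of_int q\<bar>)
    \<and> (\<forall>\<mu> \<nu>. odd_numerator_rep \<alpha> \<mu> \<nu> \<longrightarrow> C_inf \<alpha> = 1 / of_nat \<nu>)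
    \<and> (\<not> odd_numerator_fraction \<alpha> \<longrightarrow> C_inf \<alpha> = 0)
    \<and> (odd_numerator_fraction \<alpha> \<longrightarrow> C_inf \<alpha> > 0)"
proof (intro conjI allI impI)
  show "C_inf \<alpha> = (INF (p, q)\<in>(UNIV :: (int \<times> int) set). \<bar>(2 * of_int p + 1) * \<alpha> - 2 * of_int q\<bar>)"
    using C_inf_eq_INF[of \<alpha>] by (simp add: odd_even_gap_def)
  show "C_inf \<alpha> = 1 / of_nat \<nu>" if "odd_numerator_rep \<alpha> \<mu> \<nu>" for \<mu> \<nu>
    using that by (rule C_inf_odd_numerator)
  show "C_inf \<alpha> = 0" if "\<not> odd_numerator_fraction \<alpha>"
    using that C_inf_irrational C_inf_rational by blast
  show "C_inf \<alpha> > 0" if "odd_numerator_fraction \<alpha>"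
    using that C_inf_odd_numerator
    by (auto simp: odd_numerator_fraction_def odd_numerator_rep_def)
qed

end
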